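(* Let $q$ be a prime power and let $S$ be a set of $q+1$ points in $\mathrm{PG}(2,q)$. If $S$ has degree at most $3$, then $u_0(S)\ge q(q-2)/3$. If $S$ has degree at most $4$ and $u_3(S)=c$, then $u_0(S)\ge (q^2-3q+2c)/4$.
   Context: $\mathrm{PG}(2,q)$ is the projective plane over $\mathbb{F}_q$. For a set $S$ of $q+1$ points, $u_i(S)$ is the number of lines of $\mathrm{PG}(2,q)$ containing exactly $i$ points of $S$, and the degree of $S$ is the largest $i$ with $u_i(S)\neq 0$. *)

theory Defs
  imports "HOL-Analysis.Analysis"
begin

text \<open>PG(2,q) is modelled on the type \<open>'a ^ 3\<close> over a finite field \<open>'a\<close> with q elements;
  a point \<open>P\<close> lies on a line \<open>L\<close> iff \<open>P \<subseteq> L\<close>.\<close>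

definition pg_points :: "(('a::field) ^ 3) set set" where
  "pg_points = {P. vec.subspace P \<and> vec.dim P = 1}"

definition pg_lines :: "(('a::field) ^ 3) set set" where
  "pg_lines = {L. vec.subspace L \<and> vec.dim L = 2}"

definition num_secants :: "nat \<Rightarrow> (('a::field) ^ 3) set set \<Rightarrow> nat" where
  "num_secants i S = card {L \<in> pg_lines. card {P \<in> S. P \<subseteq> L} = i}"

definition pg_degree :: "(('a::field) ^ 3) set set \<Rightarrow> nat" where
  "pg_degree S = Max {i. num_secants i S \<noteq> 0}"

end

theory Submission
  imports Defs
begin

text \<open>Summing a quadratic polynomial in \<open>i = |S \<inter> L|\<close> over all lines \<open>L\<close> gives a number depending only
  on \<open>q\<close>, by counting lines, flags, and pairs of points. For degree \<open>k\<close> the polynomial is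
  \<open>(1 - i)(k - i) = k - k i + i(i - 1)\<close>: it equals \<open>k\<close> at \<open>i = 0\<close>, vanishes at \<open>1\<close> and \<open>k\<close>,
  and is negative in between, so its sum is at most \<open>k u\<^sub>0\<close>; for \<open>k = 4\<close> its value \<open>-2\<close> at \<open>i = 3\<close>
  supplies the term in \<open>u\<^sub>3\<close>.\<close>

section \<open>Cardinalities of subspaces over a finite field\<close>

lemma card_span_independent:
  fixes B :: "(('a::{field,finite}) ^ 'n) set"
  assumes "vec.independent B"
  shows "card (vec.span B) = CARD('a) ^ card B"
proof -
  have "finite B" by simp
  then show ?thesis using assms
  proof (induction B rule: finite_induct)
    case empty
    then show ?case by simp
  next
    case (insert a B)
    have ind: "vec.independent B" and a: "a \<notin> vec.span B"
      using insert.prems insert.hyps by (auto simp: vec.independent_insert)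
    \<comment> \<open>This map is a bijection from scalars times the span of \<open>B\<close> onto
      the span of \<open>insert a B\<close>, so each new basis vector multiplies the cardinality by
      q.\<close>
    let ?f = "\<lambda>(c, x). c *s a + x"
    have "vec.span (insert a B) = ?f ` (UNIV \<times> vec.span B)"
    proof (intro equalityI subsetI)
      fix x assume "x \<in> vec.span (insert a B)"
      then obtain k where "x - k *s a \<in> vec.span B"
        by (auto simp: vec.span_insert)
      then show "x \<in> ?f ` (UNIV \<times> vec.span B)"
        by (intro image_eqI[of _ _ "(k, x - k *s a)"]) auto
    next
      fix x assume "x \<in> ?f ` (UNIV \<times> vec.span B)"
      then obtain c y where y: "y \<in> vec.span B" "x = c *s a + y" by auto
      then have "x - c *s a \<in> vec.span B" by simp
      then show "x \<in> vec.span (insert a B)" by (auto simp: vec.span_insert)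
    qed
    moreover have "inj_on ?f (UNIV \<times> vec.span B)"
    proof (rule inj_onI, clarsimp)
      fix c x d y
      assume x: "x \<in> vec.span B" and y: "y \<in> vec.span B" and e: "c *s a + x = d *s a + y"
      have "(c - d) *s a = y - x"
        using e by (simp add: vec.scale_left_diff_distrib algebra_simps)
      then have s: "(c - d) *s a \<in> vec.span B" using x y by (simp add: vec.span_diff)
      \<comment> \<open>Otherwise \<open>c - d\<close> is invertible, and scaling by its inverse
        puts \<open>a\<close> itself into the span of \<open>B\<close>.\<close>
      have "c = d"
      proof (rule ccontr)
        assume "c \<noteq> d"
        then have "inverse (c - d) *s ((c - d) *s a) = a"
          by (simp only: vec.scale_scale) simp
        then show False using vec.span_scale[OF s, of "inverse (c - d)"] a by simp
      qed
      then show "c = d \<and> x = y" using e by simp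
    qed
    ultimately have "card (vec.span (insert a B)) = CARD('a) * card (vec.span B)"
      by (simp add: card_image card_cartesian_product)
    then show ?case using insert ind by simp
  qed
qed

lemma card_subspace:
  fixes V :: "(('a::{field,finite}) ^ 'n) set"
  assumes "vec.subspace V"
  shows "card V = CARD('a) ^ vec.dim V"
proof -
  obtain B where B: "B \<subseteq> V" "vec.independent B" "V \<subseteq> vec.span B" "card B = vec.dim V"
    using vec.basis_exists by blast
  then have "V = vec.span B" using assms vec.span_minimal by blast
  then show ?thesis using card_span_independent[OF B(2)] B(4) by simp
qed

section \<open>The line joining two points, in terms of vectors\<close>

lemma independent_pair:
  fixes v w :: "('a::field) ^ 'n"
  assumes "v \<noteq> 0" "w \<notin> vec.span {v}"
  shows "vec.independent {v, w}" "v \<noteq> w"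
proof -
  show "v \<noteq> w" using assms vec.span_base by blast
  have "vec.independent {v}" using assms(1) by simp
  then have "vec.independent (insert w {v})" using assms(2) by (simp add: vec.independent_insert)
  then show "vec.independent {v, w}" by (simp add: insert_commute)
qed

lemma span_pair_line:
  fixes v w :: "('a::field) ^ 3"
  assumes "v \<noteq> 0" "w \<notin> vec.span {v}"
  shows "vec.span {v, w} \<in> pg_lines"
  using independent_pair[OF assms]
  by (simp add: pg_lines_def vec.dim_eq_card_independent)

text \<open>The span lies inside L and both have dimension 2. Together with
  \<open>span_pair_line\<close> this says that two independent vectors determine exactly one
  line.\<close>

lemma line_eq_span_pair:
  fixes v w :: "('a::field) ^ 3"
  assumes "v \<noteq> 0" "w \<notin> vec.span {v}" "L \<in> pg_lines" "v \<in> L" "w \<in> L"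
  shows "L = vec.span {v, w}"
proof -
  have L: "vec.subspace L" "vec.dim L = 2" using assms(3) by (auto simp: pg_lines_def)
  have "vec.span {v, w} \<subseteq> L" using assms L by (intro vec.span_minimal) auto
  moreover have "vec.dim L \<le> vec.dim (vec.span {v, w})"
    using span_pair_line[OF assms(1,2)] L(2) by (simp add: pg_lines_def)
  ultimately show ?thesis
    using vec.subspace_dim_equal[OF vec.subspace_span L(1)] by blast
qed

section \<open>Numbers of lines in the plane and through a vector\<close>

lemma card_line:
  fixes L :: "(('a::{field,finite}) ^ 3) set"
  assumes "L \<in> pg_lines"
  shows "card L = CARD('a)\<^sup>2"
  using assms card_subspace[of L] by (auto simp: pg_lines_def)

lemma card_space: "card (UNIV :: (('a::{field,finite}) ^ 3) set) = CARD('a) ^ 3"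
  using card_subspace[OF vec.subspace_UNIV] by (simp add: vec.dim_UNIV)

text \<open>Holds since 0 and 1 differ. The double counts below cancel q^2 - q and q^2 - 1, which
  must therefore be nonzero.\<close>

lemma CARD_field_gt_1: "CARD('a::{field,finite}) > 1"
proof -
  have "card {0, 1 :: 'a} \<le> CARD('a)" by (rule card_mono) auto
  then show ?thesis by simp
qed

text \<open>Count pairs (L, w) with v and w on L and w outside the span of v. Each such w fixes L,
  and each L carries q^2 - q choices of w, so the number of lines is (q^3 - q) / (q^2 - q). Counting
  vectors rather than points avoids passing to classes modulo scalars.\<close>

lemma card_lines_through:
  fixes v :: "('a::{field,finite}) ^ 3"
  assumes "v \<noteq> 0"
  shows "card {L \<in> pg_lines. v \<in> L} = CARD('a) + 1"
proof -
  let ?q = "CARD('a)" and ?A = "{L \<in> pg_lines. v \<in> L}" and ?B = "- vec.span {v}"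
  have q: "?q > 1" by (rule CARD_field_gt_1)
  have cs: "card (vec.span {v}) = ?q"
    using card_span_independent[of "{v}"] assms by simp
  have "(\<Sum>L\<in>?A. card {w \<in> ?B. w \<in> L}) = (\<Sum>w\<in>?B. card {L \<in> ?A. w \<in> L})"
    by (rule sum_multicount_gen) auto
  moreover have "card {w \<in> ?B. w \<in> L} = ?q\<^sup>2 - ?q" if "L \<in> ?A" for L
  proof -
    have "vec.span {v} \<subseteq> L"
      using that by (intro vec.span_minimal) (auto simp: pg_lines_def)
    moreover have "{w \<in> ?B. w \<in> L} = L - vec.span {v}" by auto
    ultimately show ?thesis using that cs by (simp add: card_Diff_subset card_line)
  qed
  moreover have "card {L \<in> ?A. w \<in> L} = 1" if "w \<in> ?B" for w
  proof -
    have w: "w \<notin> vec.span {v}" using that by simp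
    have "{L \<in> ?A. w \<in> L} = {vec.span {v, w}}"
      using span_pair_line[OF assms w] line_eq_span_pair[OF assms w]
      by (auto intro: vec.span_base)
    then show ?thesis by simp
  qed
  ultimately have "card ?A * (?q\<^sup>2 - ?q) = card ?B" by simp
  also have "card ?B = ?q ^ 3 - ?q" by (simp add: Compl_eq_Diff_UNIV card_Diff_subset cs card_space)
  also have "\<dots> = (?q + 1) * (?q\<^sup>2 - ?q)"
    by (simp add: algebra_simps power2_eq_square power3_eq_cube)
  finally have "card ?A * (?q\<^sup>2 - ?q) = (?q + 1) * (?q\<^sup>2 - ?q)" .
  moreover have "?q\<^sup>2 - ?q \<noteq> 0" using q by (simp add: power2_eq_square)
  ultimately show ?thesis by (simp only: mult_cancel2 simp_thms)
qed

text \<open>Count pairs (L, w) with w a nonzero vector of L: every line has q^2 - 1 of them, and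
  each of the q^3 - 1 nonzero vectors is on q + 1 lines.\<close>

lemma card_pg_lines:
  "card (pg_lines :: (('a::{field,finite}) ^ 3) set set) = CARD('a)\<^sup>2 + CARD('a) + 1"
proof -
  let ?q = "CARD('a)" and ?A = "pg_lines :: ('a ^ 3) set set" and ?B = "- {0 :: 'a ^ 3}"
  have q: "?q > 1" by (rule CARD_field_gt_1)
  \<comment> \<open>Writing q as a successor removes the truncated subtractions of natural numbers
    from the identity to be checked.\<close>
  then obtain r where r: "?q = Suc r" by (cases ?q) auto
  have "(\<Sum>L\<in>?A. card {w \<in> ?B. w \<in> L}) = (\<Sum>w\<in>?B. card {L \<in> ?A. w \<in> L})"
    by (rule sum_multicount_gen) auto
  moreover have "card {w \<in> ?B. w \<in> L} = ?q\<^sup>2 - 1" if "L \<in> ?A" for L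
  proof -
    have "0 \<in> L" using that by (simp add: pg_lines_def vec.subspace_0)
    moreover have "{w \<in> ?B. w \<in> L} = L - {0}" by auto
    ultimately show ?thesis using that by (simp add: card_Diff_subset card_line)
  qed
  moreover have "card ?B = ?q ^ 3 - 1" by (simp add: Compl_eq_Diff_UNIV card_Diff_subset card_space)
  ultimately have "card ?A * (?q\<^sup>2 - 1) = (?q ^ 3 - 1) * (?q + 1)"
    by (simp add: card_lines_through)
  also have "(?q ^ 3 - 1) * (?q + 1) = (?q\<^sup>2 + ?q + 1) * (?q\<^sup>2 - 1)"
    unfolding r by (simp add: algebra_simps power2_eq_square power3_eq_cube)
  finally have "card ?A * (?q\<^sup>2 - 1) = (?q\<^sup>2 + ?q + 1) * (?q\<^sup>2 - 1)" .
  moreover have "?q\<^sup>2 - 1 \<noteq> 0" using q unfolding r by (simp add: power2_eq_square)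
  ultimately show ?thesis by (simp only: mult_cancel2 simp_thms)
qed

section \<open>Projective points and the lines through them\<close>

lemma pg_point_eq_span:
  fixes P :: "(('a::field) ^ 3) set"
  assumes "P \<in> pg_points"
  obtains v where "v \<noteq> 0" "P = vec.span {v}"
proof -
  have P: "vec.subspace P" "vec.dim P = 1" using assms by (auto simp: pg_points_def)
  obtain B where B: "B \<subseteq> P" "vec.independent B" "P \<subseteq> vec.span B" "card B = vec.dim P"
    using vec.basis_exists by blast
  then obtain v where v: "B = {v}" using P(2) by (auto simp: card_1_singleton_iff)
  have "v \<noteq> 0" using B(2) v by simp
  moreover have "P = vec.span {v}" using B(1,3) v P(1) vec.span_minimal by blast
  ultimately show ?thesis by (rule that)
qed

text \<open>Turns incidence of a point with a line into membership of a representative vector, so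
  that the vector counts carry over to points.\<close>

lemma span_singleton_subset_line_iff:
  fixes v :: "('a::field) ^ 3"
  assumes "L \<in> pg_lines"
  shows "vec.span {v} \<subseteq> L \<longleftrightarrow> v \<in> L"
  using assms vec.span_minimal[of "{v}" L] vec.span_base[of v "{v}"] by (auto simp: pg_lines_def)

lemma card_lines_through_point:
  fixes P :: "(('a::{field,finite}) ^ 3) set"
  assumes "P \<in> pg_points"
  shows "card {L \<in> pg_lines. P \<subseteq> L} = CARD('a) + 1"
proof -
  obtain v where v: "v \<noteq> 0" "P = vec.span {v}" using pg_point_eq_span[OF assms] .
  have "{L \<in> pg_lines. P \<subseteq> L} = {L \<in> pg_lines. v \<in> L}"
    using v span_singleton_subset_line_iff by blast
  then show ?thesis using card_lines_through[OF v(1)] by simp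
qed

lemma card_lines_through_two_points:
  fixes P Q :: "(('a::field) ^ 3) set"
  assumes "P \<in> pg_points" "Q \<in> pg_points" "P \<noteq> Q"
  shows "card {L \<in> pg_lines. P \<subseteq> L \<and> Q \<subseteq> L} = 1"
proof -
  obtain v where v: "v \<noteq> 0" "P = vec.span {v}" using pg_point_eq_span[OF assms(1)] .
  obtain w where w: "w \<noteq> 0" "Q = vec.span {w}" using pg_point_eq_span[OF assms(2)] .
  \<comment> \<open>Dependent representatives would give \<open>Q \<subseteq> P\<close>, and equal
    dimensions would then force the two points to coincide.\<close>
  have nw: "w \<notin> vec.span {v}"
  proof
    assume "w \<in> vec.span {v}"
    then have "Q \<subseteq> P" using v w by (simp add: vec.span_minimal)
    moreover have "vec.dim P \<le> vec.dim Q" using assms by (simp add: pg_points_def)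
    ultimately have "Q = P"
      using assms(1,2) by (intro vec.subspace_dim_equal) (auto simp: pg_points_def)
    then show False using assms(3) by simp
  qed
  have "{L \<in> pg_lines. P \<subseteq> L \<and> Q \<subseteq> L} = {L \<in> pg_lines. v \<in> L \<and> w \<in> L}"
    using v w span_singleton_subset_line_iff by blast
  also have "\<dots> = {vec.span {v, w}}"
    using span_pair_line[OF v(1) nw] line_eq_span_pair[OF v(1) nw]
    by (auto intro: vec.span_base)
  finally show ?thesis by simp
qed

section \<open>Incidence counts for a point set\<close>

lemma sum_line_points:
  fixes S :: "(('a::{field,finite}) ^ 3) set set"
  assumes "S \<subseteq> pg_points"
  shows "(\<Sum>L\<in>pg_lines. card {P \<in> S. P \<subseteq> L}) = card S * (CARD('a) + 1)"
proof -
  have "(\<Sum>L\<in>pg_lines. card {P \<in> S. P \<subseteq> L}) = (\<Sum>P\<in>S. card {L \<in> pg_lines. P \<subseteq> L})"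
    by (rule sum_multicount_gen) auto
  also have "\<dots> = (\<Sum>P\<in>S. CARD('a) + 1)"
    using assms by (intro sum.cong) (auto simp: card_lines_through_point)
  finally show ?thesis by simp
qed

lemma card_pairs_distinct:
  assumes "finite T"
  shows "card {x \<in> T \<times> T. fst x \<noteq> snd x} = card T * (card T - 1)"
proof -
  have "{x \<in> T \<times> T. fst x \<noteq> snd x} = (SIGMA x:T. T - {x})" by auto
  then show ?thesis using assms by simp
qed

text \<open>Double count of triples (P, Q, L) with P, Q distinct points of S on L: every pair is on
  exactly one line. Ordered pairs are used, so no binomial coefficients or halves appear.\<close>

lemma sum_line_point_pairs:
  fixes S :: "(('a::{field,finite}) ^ 3) set set"
  assumes "S \<subseteq> pg_points"
  shows "(\<Sum>L\<in>pg_lines. card {P \<in> S. P \<subseteq> L} * (card {P \<in> S. P \<subseteq> L} - 1)) = card S * (card S - 1)"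
proof -
  let ?D = "{x \<in> S \<times> S. fst x \<noteq> snd x}"
  have "(\<Sum>L\<in>pg_lines. card {P \<in> S. P \<subseteq> L} * (card {P \<in> S. P \<subseteq> L} - 1))
      = (\<Sum>L\<in>pg_lines. card {x \<in> ?D. fst x \<subseteq> L \<and> snd x \<subseteq> L})"
  proof (rule sum.cong[OF refl])
    fix L :: "('a ^ 3) set"
    let ?T = "{P \<in> S. P \<subseteq> L}"
    have "{x \<in> ?D. fst x \<subseteq> L \<and> snd x \<subseteq> L} = {x \<in> ?T \<times> ?T. fst x \<noteq> snd x}" by auto
    then show "card ?T * (card ?T - 1) = card {x \<in> ?D. fst x \<subseteq> L \<and> snd x \<subseteq> L}"
      using card_pairs_distinct[of ?T] by simp
  qed
  also have "\<dots> = (\<Sum>x\<in>?D. card {L \<in> pg_lines. fst x \<subseteq> L \<and> snd x \<subseteq> L})"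
    by (rule sum_multicount_gen) auto
  also have "\<dots> = (\<Sum>x\<in>?D. 1)"
    using assms by (intro sum.cong refl card_lines_through_two_points) auto
  also have "\<dots> = card S * (card S - 1)" by (simp add: card_pairs_distinct)
  finally show ?thesis .
qed

text \<open>The line L itself shows that its intersection number occurs. The bound by
  \<open>card S\<close> makes the set of occurring numbers finite, so that \<open>Max\<close> in
  \<open>pg_degree\<close> really is an upper bound.\<close>

lemma card_line_points_le_degree:
  fixes S :: "(('a::{field,finite}) ^ 3) set set"
  assumes "L \<in> pg_lines"
  shows "card {P \<in> S. P \<subseteq> L} \<le> pg_degree S"
proof -
  have "{i. num_secants i S \<noteq> 0} \<subseteq> {..card S}"
  proof
    fix i assume "i \<in> {i. num_secants i S \<noteq> 0}"
    then have "{L \<in> pg_lines. card {P \<in> S. P \<subseteq> L} = i} \<noteq> {}"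
      unfolding num_secants_def by (metis (mono_tags, lifting) card.empty mem_Collect_eq)
    then obtain M where "card {P \<in> S. P \<subseteq> M} = i" by blast
    moreover have "card {P \<in> S. P \<subseteq> M} \<le> card S" by (rule card_mono) auto
    ultimately show "i \<in> {..card S}" by simp
  qed
  then have "finite {i. num_secants i S \<noteq> 0}" using finite_subset by blast
  moreover have "num_secants (card {P \<in> S. P \<subseteq> L}) S \<noteq> 0"
    using assms by (auto simp: num_secants_def)
  ultimately show ?thesis unfolding pg_degree_def by (intro Max_ge) auto
qed

text \<open>The three counts give k(q^2 + q + 1) - k(q + 1)^2 + (q + 1)q, where the terms in k
  collapse to -kq. Leaving k free serves both degree bounds.\<close>

lemma sum_secant_polynomial:
  fixes S :: "(('a::{field,finite}) ^ 3) set set" and k :: real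
  assumes "S \<subseteq> pg_points" "card S = CARD('a) + 1"
  defines "n \<equiv> \<lambda>L. real (card {P \<in> S. P \<subseteq> L})"
  shows "(\<Sum>L\<in>pg_lines. (1 - n L) * (k - n L)) = real CARD('a) * (real CARD('a) + 1 - k)"
proof -
  let ?q = "real CARD('a)"
  have s0: "real (card (pg_lines :: ('a ^ 3) set set)) = ?q\<^sup>2 + ?q + 1"
    by (simp add: card_pg_lines)
  have "(\<Sum>L\<in>pg_lines. n L) = real (\<Sum>L\<in>pg_lines. card {P \<in> S. P \<subseteq> L})"
    by (simp add: n_def)
  then have s1: "(\<Sum>L\<in>pg_lines. n L) = (?q + 1) * (?q + 1)"
    using sum_line_points[OF assms(1)] assms(2) by (simp add: algebra_simps)
  have "(\<Sum>L\<in>pg_lines. n L * (n L - 1))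
      = real (\<Sum>L\<in>pg_lines. card {P \<in> S. P \<subseteq> L} * (card {P \<in> S. P \<subseteq> L} - 1))"
    unfolding of_nat_sum
  proof (rule sum.cong[OF refl])
    show "n L * (n L - 1) = real (card {P \<in> S. P \<subseteq> L} * (card {P \<in> S. P \<subseteq> L} - 1))" for L
      \<comment> \<open>Natural subtraction truncates only when the count is 0, and there the factor
        in front makes both sides 0.\<close>
      by (cases "card {P \<in> S. P \<subseteq> L}") (simp_all add: n_def algebra_simps)
  qed
  then have s2: "(\<Sum>L\<in>pg_lines. n L * (n L - 1)) = (?q + 1) * ?q"
    unfolding sum_line_point_pairs[OF assms(1)] assms(2) by (simp add: distrib_right)
  have "(\<Sum>L\<in>pg_lines. (1 - n L) * (k - n L))
      = (\<Sum>L\<in>pg_lines. k - k * n L + n L * (n L - 1))"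
    by (simp add: algebra_simps)
  also have "\<dots> = real (card (pg_lines :: ('a ^ 3) set set)) * k - k * (\<Sum>L\<in>pg_lines. n L)
      + (\<Sum>L\<in>pg_lines. n L * (n L - 1))"
    by (simp only: sum.distrib sum_subtractf sum_distrib_left sum_constant)
  also have "\<dots> = ?q * (?q + 1 - k)"
    unfolding s0 s1 s2 by (simp add: algebra_simps power2_eq_square)
  finally show ?thesis .
qed

text \<open>As sums of indicators over all lines, secant numbers can be compared with the polynomial
  sum line by line.\<close>

lemma num_secants_eq_sum:
  fixes S :: "(('a::{field,finite}) ^ 3) set set"
  shows "real (num_secants i S) = (\<Sum>L\<in>pg_lines. of_bool (card {P \<in> S. P \<subseteq> L} = i))"
  by (simp add: num_secants_def Int_def)

theorem theorem4p16:
  fixes S :: "(('a::{field,finite}) ^ 3) set set" and q :: nat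
  assumes "CARD('a) = q"
    and "S \<subseteq> pg_points"
    and "card S = q + 1"
  shows "(pg_degree S \<le> 3 \<longrightarrow>
            real (num_secants 0 S) \<ge> real q * (real q - 2) / 3) \<and>
         (\<forall>c. pg_degree S \<le> 4 \<and> num_secants 3 S = c \<longrightarrow>
            real (num_secants 0 S) \<ge> ((real q)\<^sup>2 - 3 * real q + 2 * real c) / 4)"
proof (intro conjI impI allI)
  define n where "n = (\<lambda>L. card {P \<in> S. P \<subseteq> L})"
  have poly: "(\<Sum>L\<in>pg_lines. (1 - real (n L)) * (k - real (n L))) = real q * (real q + 1 - k)" for k
    using sum_secant_polynomial[of S k] assms by (simp add: n_def)
  have secants: "real (num_secants i S) = (\<Sum>L\<in>pg_lines. of_bool (n L = i))" for i
    by (simp add: num_secants_eq_sum n_def)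
  have le: "n L \<le> pg_degree S" if "L \<in> pg_lines" for L
    using card_line_points_le_degree[OF that] by (simp add: n_def)
  show "real (num_secants 0 S) \<ge> real q * (real q - 2) / 3" if "pg_degree S \<le> 3"
  proof -
    \<comment> \<open>For n = 0, 1, 2, 3 the left summand is 3, 0, -1, 0 and the right one 3, 0, 0,
      0. The left total is q(q - 2).\<close>
    have "(\<Sum>L\<in>pg_lines. (1 - real (n L)) * (3 - real (n L))) \<le> (\<Sum>L\<in>pg_lines. 3 * of_bool (n L = 0))"
    proof (rule sum_mono)
      fix L :: "('a ^ 3) set" assume "L \<in> pg_lines"
      then have "n L \<le> 3" using le[of L] that by simp
      then consider "n L = 0" | "n L = 1" | "n L = 2" | "n L = 3" by linarith
      then show "(1 - real (n L)) * (3 - real (n L)) \<le> 3 * of_bool (n L = 0)"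
        by cases simp_all
    qed
    then show ?thesis
      unfolding poly sum_distrib_left[symmetric] secants[symmetric] by simp
  qed
  show "real (num_secants 0 S) \<ge> ((real q)\<^sup>2 - 3 * real q + 2 * real c) / 4"
    if "pg_degree S \<le> 4 \<and> num_secants 3 S = c" for c
  proof -
    \<comment> \<open>For n = 0, 1, 2, 3, 4 the left summand is 4, 0, -2, -2, 0 and the right one 4,
      0, 0, -2, 0: slack comes only from lines with two points, and lines with three are accounted
      for exactly.\<close>
    have "(\<Sum>L\<in>pg_lines. (1 - real (n L)) * (4 - real (n L)))
        \<le> (\<Sum>L\<in>pg_lines. 4 * of_bool (n L = 0) - 2 * of_bool (n L = 3))"
    proof (rule sum_mono)
      fix L :: "('a ^ 3) set" assume "L \<in> pg_lines"
      then have "n L \<le> 4" using le[of L] that by simp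
      then consider "n L = 0" | "n L = 1" | "n L = 2" | "n L = 3" | "n L = 4" by linarith
      then show "(1 - real (n L)) * (4 - real (n L)) \<le> 4 * of_bool (n L = 0) - 2 * of_bool (n L = 3)"
        by cases simp_all
    qed
    then have "real q * (real q + 1 - 4) \<le> 4 * real (num_secants 0 S) - 2 * real c"
      unfolding poly sum_subtractf sum_distrib_left[symmetric] secants[symmetric] using that by simp
    then show ?thesis by (simp add: algebra_simps power2_eq_square)
  qed
qed

end
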